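(* Let $b$ be an algebraic number such that the critical point $0$ of $f=T^2+b$ is $f$-periodic of period length $n$. Let $\alpha$ be an $f$-preperiodic algebraic number. Then $$2^{\,\mathrm{preper}(\alpha)-1}\le[\mathbb{Q}(b,\alpha):\mathbb{Q}(b)]\quad\text{and}\quad\mathrm{per}(\alpha)\le n\,[\mathbb{Q}(b,\alpha):\mathbb{Q}(b)].$$
   Context: $f^{(m)}$ is the $m$-th iterate of $f$, $f^{(0)}=T$. A point $\alpha$ is $f$-preperiodic if its forward orbit $\{f^{(m)}(\alpha):m\ge0\}$ is finite, and $f$-periodic if $f^{(m)}(\alpha)=\alpha$ for some $m\ge1$; the minimal such $m$ is its period length. For preperiodic $\alpha$, $\mathrm{preper}(\alpha)$ is the least $m\ge0$ such that $f^{(m)}(\alpha)$ is periodic, and $\mathrm{per}(\alpha)$ is the period length of $f^{(m)}(\alpha)$ for that $m$ (the period length of the cycle eventually reached). *)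

theory Defs
  imports
    Complex_Main
    "HOL-Computational_Algebra.Polynomial"
    "HOL-Algebra.Generated_Fields"
    "HOL-Algebra.Embedded_Algebras"
    "HOL-Algebra.Algebraic_Closure_Type"
begin

definition is_periodic :: "('a \<Rightarrow> 'a) \<Rightarrow> 'a \<Rightarrow> bool" where
  "is_periodic f x \<longleftrightarrow> (\<exists>m\<ge>1. (f ^^ m) x = x)"

definition period_length :: "('a \<Rightarrow> 'a) \<Rightarrow> 'a \<Rightarrow> nat" where
  "period_length f x = (LEAST m. m \<ge> 1 \<and> (f ^^ m) x = x)"

definition is_preperiodic :: "('a \<Rightarrow> 'a) \<Rightarrow> 'a \<Rightarrow> bool" where
  "is_preperiodic f x \<longleftrightarrow> finite {(f ^^ m) x | m. m \<ge> 0}"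

definition preper :: "('a \<Rightarrow> 'a) \<Rightarrow> 'a \<Rightarrow> nat" where
  "preper f x = (LEAST m. is_periodic f ((f ^^ m) x))"

definition per :: "('a \<Rightarrow> 'a) \<Rightarrow> 'a \<Rightarrow> nat" where
  "per f x = period_length f ((f ^^ preper f x) x)"

text \<open>
  Algebraic numbers are taken inside the complex field. As the characteristic is 0, the
  subfield generated by \<open>H\<close> contains the rationals, so it is \<open>\<rat>(H)\<close>.
\<close>

definition rat_adjoin :: "complex set \<Rightarrow> complex set" where
  "rat_adjoin H = generate_field ring_of_type_algebra H"

text \<open>
  The degree of \<open>L\<close> over \<open>K\<close>, for subfields \<open>K \<subseteq> L\<close> of the complex field with \<open>L\<close>
  finite-dimensional over \<open>K\<close>; it is unspecified for infinite extensions.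
\<close>

definition ext_degree :: "complex set \<Rightarrow> complex set \<Rightarrow> nat" where
  "ext_degree L K = ring.dim ring_of_type_algebra K L"

end

theory Submission
  imports Defs "HOL-Library.Function_Algebras" "Jordan_Normal_Form.Char_Poly"
begin

text \<open>
  Write \<open>F(x) = x\<^sup>2 + b\<close>. Modulo 2 one has \<open>F\<^sup>k(x) \<equiv> x^(2^k) + F\<^sup>k(0)\<close>, and
  \<open>F\<^sup>n(0) = 0\<close>, so that \<open>F\<^sup>n\<close> acts as a power of Frobenius. Hence for a periodic
  point \<open>\<beta>\<close> the ring \<open>R = \<int>[b, \<beta>]\<close> is unramified at 2, in the elementary sense that
  \<open>x^q \<equiv> x (mod 2R)\<close> for all \<open>x \<in> R\<close> and a fixed \<open>q \<ge> 2\<close>.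

  Period: Frobenius lifts, i.e. \<open>F\<^sup>n(\<beta>)\<close> is a conjugate of \<open>\<beta>\<close> over \<open>\<rat>(b)\<close>. All the points
  \<open>\<beta>, F\<^sup>n(\<beta>), F\<^bsup>2n\<^esup>(\<beta>), \<dots>\<close> are therefore roots of the minimal polynomial of \<open>\<beta>\<close>, and there are
  at least \<open>per(\<beta>)/n\<close> of them.

  Preperiod: if \<open>m = preper(\<alpha>) \<ge> 1\<close>, then \<open>F\<^bsup>m-1\<^esup>(\<alpha>) = -\<beta>\<close> for a nonzero periodic
  \<open>\<beta>\<close>, which is a unit of \<open>R\<close> since the critical point 0 is periodic as well. Let \<open>\<alpha>'\<close> be the
  point of the cycle of \<open>\<beta>\<close> with \<open>F\<^bsup>m-1\<^esup>(\<alpha>') = \<beta>\<close>. Then \<open>u = \<alpha> - \<alpha>'\<close> is a root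
  of a polynomial of degree \<open>2^(m-1)\<close> over \<open>R\<close> that is Eisenstein at 2, with constant term \<open>2\<beta>\<close>.
\<close>

section \<open>Frobenius modulo 2\<close>

text \<open>Working over \<open>comm_ring_1\<close> instead of a field admits the ring of functions
  on \<open>bool\<close>, which has zero divisors.\<close>

locale unital_subring =
  fixes R :: "'a :: comm_ring_1 set"
  assumes one_mem [simp, intro]: "1 \<in> R"
    and diff_mem [intro]: "\<And>x y. x \<in> R \<Longrightarrow> y \<in> R \<Longrightarrow> x - y \<in> R"
    and mult_mem [intro]: "\<And>x y. x \<in> R \<Longrightarrow> y \<in> R \<Longrightarrow> x * y \<in> R"
begin

lemma zero_mem [simp, intro]: "0 \<in> R"
  using diff_mem[OF one_mem one_mem] by simp

lemma uminus_mem [intro]: "x \<in> R \<Longrightarrow> - x \<in> R"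
  using diff_mem[OF zero_mem, of x] by simp

lemma add_mem [intro]: "x \<in> R \<Longrightarrow> y \<in> R \<Longrightarrow> x + y \<in> R"
  using diff_mem[OF _ uminus_mem, of x y] by simp

lemma power_mem [intro]: "x \<in> R \<Longrightarrow> x ^ k \<in> R"
  by (induction k) auto

lemma sum_mem [intro]: "(\<And>i. i \<in> I \<Longrightarrow> f i \<in> R) \<Longrightarrow> sum f I \<in> R"
  by (induction I rule: infinite_finite_induct) auto

lemma of_nat_mem [simp, intro]: "of_nat k \<in> R"
  by (induction k) auto

lemma of_int_mem [simp, intro]: "of_int k \<in> R"
  by (cases k) (auto simp del: of_nat_Suc)

lemma numeral_mem [simp, intro]: "numeral k \<in> R"
  using of_nat_mem[of "numeral k"] by simp

text \<open>Congruence modulo the ideal \<open>2R\<close>. The quotient must lie in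
  \<open>R\<close>, since 2 is invertible in a field of characteristic 0.\<close>

definition cong2 :: "'a \<Rightarrow> 'a \<Rightarrow> bool"
  where "cong2 x y \<longleftrightarrow> (\<exists>r\<in>R. x = y + 2 * r)"

lemma cong2_refl [simp, intro]: "cong2 x x"
  unfolding cong2_def by (rule bexI[of _ 0]) auto

lemma cong2_sym: assumes "cong2 x y" shows "cong2 y x"
proof -
  obtain r where "r \<in> R" "x = y + 2 * r" using assms by (auto simp: cong2_def)
  then show ?thesis unfolding cong2_def by (intro bexI[of _ "- r"]) auto
qed

lemma cong2_trans [trans]: assumes "cong2 x y" "cong2 y z" shows "cong2 x z"
proof -
  obtain r s where "r \<in> R" "x = y + 2 * r" "s \<in> R" "y = z + 2 * s"
    using assms by (auto simp: cong2_def)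
  then show ?thesis unfolding cong2_def by (intro bexI[of _ "r + s"]) (auto simp: algebra_simps)
qed

lemma cong2_add: assumes "cong2 x y" "cong2 x' y'" shows "cong2 (x + x') (y + y')"
proof -
  obtain r s where "r \<in> R" "x = y + 2 * r" "s \<in> R" "x' = y' + 2 * s"
    using assms by (auto simp: cong2_def)
  then show ?thesis unfolding cong2_def by (intro bexI[of _ "r + s"]) (auto simp: algebra_simps)
qed

lemma cong2_diff: assumes "cong2 x y" "cong2 x' y'" shows "cong2 (x - x') (y - y')"
proof -
  obtain r s where "r \<in> R" "x = y + 2 * r" "s \<in> R" "x' = y' + 2 * s"
    using assms by (auto simp: cong2_def)
  then show ?thesis unfolding cong2_def by (intro bexI[of _ "r - s"]) (auto simp: algebra_simps)
qed

lemma cong2_mult: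
  assumes "cong2 x y" "cong2 x' y'" "y \<in> R" "y' \<in> R"
  shows "cong2 (x * x') (y * y')"
proof -
  obtain r s where rs: "r \<in> R" "x = y + 2 * r" "s \<in> R" "x' = y' + 2 * s"
    using assms by (auto simp: cong2_def)
  have "x * x' = y * y' + 2 * (r * y' + y * s + 2 * (r * s))"
    by (simp add: rs algebra_simps)
  moreover have "r * y' + y * s + 2 * (r * s) \<in> R"
    using rs assms by auto
  ultimately show ?thesis unfolding cong2_def by blast
qed

lemma cong2_power: assumes "cong2 x y" "y \<in> R" shows "cong2 (x ^ k) (y ^ k)"
  by (induction k) (auto intro!: cong2_mult assms)

lemma cong2_sqr_add:
  assumes "x \<in> R" "y \<in> R"
  shows "cong2 ((x + y)\<^sup>2) (x\<^sup>2 + y\<^sup>2)"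
  unfolding cong2_def using assms
  by (intro bexI[of _ "x * y"]) (auto simp: power2_sum)

lemma cong2_sqr_diff:
  assumes "x \<in> R" "y \<in> R"
  shows "cong2 ((x - y)\<^sup>2) (x\<^sup>2 - y\<^sup>2)"
proof -
  have "(x - y)\<^sup>2 = (x\<^sup>2 - y\<^sup>2) + 2 * (y\<^sup>2 - x * y)"
    by (simp add: power2_eq_square algebra_simps)
  then show ?thesis unfolding cong2_def using assms by blast
qed

text \<open>Modulo 2 squaring is additive and signs do not matter. Differences are treated because
  \<open>int_adjoin\<close> is built from them.\<close>

lemma cong2_frobenius_diff:
  assumes "x \<in> R" "y \<in> R"
  shows "cong2 ((x - y) ^ (2 ^ k)) (x ^ (2 ^ k) - y ^ (2 ^ k))"
proof (induction k)
  case (Suc k)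
  have "cong2 (((x - y) ^ (2 ^ k))\<^sup>2) ((x ^ (2 ^ k) - y ^ (2 ^ k))\<^sup>2)"
    by (rule cong2_power[OF Suc]) (use assms in auto)
  also have "cong2 \<dots> ((x ^ (2 ^ k))\<^sup>2 - (y ^ (2 ^ k))\<^sup>2)"
    by (rule cong2_sqr_diff) (use assms in auto)
  finally show ?case by (simp add: power_mult [symmetric] mult.commute)
qed auto

end

text \<open>The ring \<int>[G]; the inductive form reduces a property of its elements to 1,
  \<open>G\<close>, differences and products.\<close>

inductive_set int_adjoin :: "'a :: comm_ring_1 set \<Rightarrow> 'a set"
  for G where
    one: "1 \<in> int_adjoin G"
  | gen: "g \<in> G \<Longrightarrow> g \<in> int_adjoin G"
  | diff: "x \<in> int_adjoin G \<Longrightarrow> y \<in> int_adjoin G \<Longrightarrow> x - y \<in> int_adjoin G"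
  | mult: "x \<in> int_adjoin G \<Longrightarrow> y \<in> int_adjoin G \<Longrightarrow> x * y \<in> int_adjoin G"

interpretation int_adjoin: unital_subring "int_adjoin G" for G
  by standard (auto intro: int_adjoin.intros)

lemma (in unital_subring) int_adjoin_subset:
  assumes "G \<subseteq> R"
  shows "int_adjoin G \<subseteq> R"
proof
  fix x assume "x \<in> int_adjoin G"
  then show "x \<in> R" using assms by induction auto
qed

abbreviation quad :: "'a :: comm_ring_1 \<Rightarrow> 'a \<Rightarrow> 'a"
  where "quad b x \<equiv> x\<^sup>2 + b"

lemma funpow_fixed_mult: "(f ^^ N) x = x \<Longrightarrow> (f ^^ (N * k)) x = x"
  by (induction k) (auto simp: funpow_add)

context unital_subring
begin

lemma quad_iter_mem:
  assumes "b \<in> R" "x \<in> R"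
  shows "(quad b ^^ k) x \<in> R"
  by (induction k) (use assms in auto)

text \<open>With \<open>c\<close> the iterate of 0, squaring \<open>x ^ (2 ^ k) + c\<close> gives
  \<open>x ^ (2 ^ Suc k) + c\<^sup>2\<close> modulo 2, and \<open>c\<^sup>2 + b\<close> is the next
  iterate of 0.\<close>

lemma quad_iter_frobenius:
  assumes "b \<in> R" "x \<in> R"
  shows "cong2 ((quad b ^^ k) x) (x ^ (2 ^ k) + (quad b ^^ k) 0)"
proof (induction k)
  case (Suc k)
  let ?c = "(quad b ^^ k) 0"
  have c: "?c \<in> R" using assms by (auto intro: quad_iter_mem)
  have "cong2 (((quad b ^^ k) x)\<^sup>2) ((x ^ (2 ^ k) + ?c)\<^sup>2)"
    by (rule cong2_power[OF Suc]) (use assms c in auto)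
  also have "cong2 \<dots> ((x ^ (2 ^ k))\<^sup>2 + ?c\<^sup>2)"
    by (rule cong2_sqr_add) (use assms c in auto)
  finally have "cong2 (((quad b ^^ k) x)\<^sup>2 + b) ((x ^ (2 ^ k))\<^sup>2 + ?c\<^sup>2 + b)"
    by (rule cong2_add) simp
  then show ?case by (simp add: power_mult [symmetric] mult.commute add.assoc)
qed auto

end

text \<open>\<open>b\<close> is the image of 0, hence lies on the critical cycle.\<close>

lemma quad_iter_param:
  assumes "(quad b ^^ n) 0 = 0"
  shows "(quad b ^^ n) b = b"
  using funpow_swap1[of "quad b" n 0] assms by simp

text \<open>After \<open>n * N\<close> steps 0, \<open>b\<close> and \<open>y\<close> have all
  returned, so \<open>quad_iter_frobenius\<close> gives the congruence for the generators; the
  elements satisfying it form a ring.\<close>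

lemma int_adjoin_frobenius:
  assumes n: "(quad b ^^ n) 0 = 0" and N: "(quad b ^^ N) y = y"
    and x: "x \<in> int_adjoin {b, y}"
  shows "int_adjoin.cong2 {b, y} (x ^ (2 ^ (n * N))) x"
  using x
proof induction
  case (gen g)
  have 0: "(quad b ^^ (n * N)) 0 = 0" using n by (rule funpow_fixed_mult)
  have "(quad b ^^ (n * N)) b = b" using quad_iter_param[OF n] by (rule funpow_fixed_mult)
  moreover have "(quad b ^^ (n * N)) y = y"
    using N by (subst mult.commute) (rule funpow_fixed_mult)
  ultimately have "(quad b ^^ (n * N)) g = g" using gen by auto
  then show ?case
    using int_adjoin.quad_iter_frobenius[of b "{b, y}" g "n * N"] 0 gen
    by (auto intro: int_adjoin.cong2_sym int_adjoin.gen)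
next
  case (diff u v)
  have "int_adjoin.cong2 {b, y} ((u - v) ^ (2 ^ (n * N))) (u ^ (2 ^ (n * N)) - v ^ (2 ^ (n * N)))"
    using diff by (intro int_adjoin.cong2_frobenius_diff)
  also have "int_adjoin.cong2 {b, y} \<dots> (u - v)"
    using diff by (intro int_adjoin.cong2_diff)
  finally show ?case .
next
  case (mult u v)
  then show ?case by (auto simp: power_mult_distrib intro: int_adjoin.cong2_mult)
qed auto

section \<open>Integrality and divisibility by 2\<close>

definition int_span :: "'a :: comm_ring_1 set \<Rightarrow> 'a set"
  where "int_span V = {\<Sum>v\<in>V. of_int (c v) * v | c. True}"

lemma int_spanI: "x = (\<Sum>v\<in>V. of_int (c v) * v) \<Longrightarrow> x \<in> int_span V"
  unfolding int_span_def by auto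

lemma int_span_zero [simp, intro]: "0 \<in> int_span V"
  by (rule int_spanI[where c = "\<lambda>_. 0"]) simp

lemma int_span_base:
  assumes "finite V" "v \<in> V"
  shows "v \<in> int_span V"
proof -
  have "v = (\<Sum>w\<in>V. of_int (if w = v then 1 else 0) * w)"
    using assms by (simp add: if_distrib [of of_int] if_distrib [of "\<lambda>c. c * _"] sum.delta cong: if_cong)
  then show ?thesis by (rule int_spanI)
qed

lemma int_span_diff:
  assumes "x \<in> int_span V" "y \<in> int_span V"
  shows "x - y \<in> int_span V"
proof -
  obtain c d where "x = (\<Sum>v\<in>V. of_int (c v) * v)" "y = (\<Sum>v\<in>V. of_int (d v) * v)"
    using assms unfolding int_span_def by blast
  then have "x - y = (\<Sum>v\<in>V. of_int (c v - d v) * v)"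
    by (simp add: sum_subtractf algebra_simps)
  then show ?thesis by (rule int_spanI)
qed

lemma int_span_add:
  assumes "x \<in> int_span V" "y \<in> int_span V"
  shows "x + y \<in> int_span V"
  using int_span_diff[OF assms(1) int_span_diff[OF int_span_zero assms(2)]] by simp

lemma int_span_sum: "(\<And>i. i \<in> I \<Longrightarrow> f i \<in> int_span V) \<Longrightarrow> sum f I \<in> int_span V"
  by (induction I rule: infinite_finite_induct) (auto intro: int_span_add)

lemma int_span_of_int_mult:
  assumes "x \<in> int_span V"
  shows "of_int k * x \<in> int_span V"
proof -
  obtain c where "x = (\<Sum>v\<in>V. of_int (c v) * v)"
    using assms unfolding int_span_def by blast
  then have "of_int k * x = (\<Sum>v\<in>V. of_int (k * c v) * v)"
    by (simp add: sum_distrib_left algebra_simps)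
  then show ?thesis by (rule int_spanI)
qed

lemma int_span_mult_closed:
  assumes "\<And>v. v \<in> V \<Longrightarrow> x * v \<in> int_span V" "y \<in> int_span V"
  shows "x * y \<in> int_span V"
proof -
  obtain c where "y = (\<Sum>v\<in>V. of_int (c v) * v)"
    using assms(2) unfolding int_span_def by blast
  then have "x * y = (\<Sum>v\<in>V. of_int (c v) * (x * v))"
    by (simp add: sum_distrib_left algebra_simps)
  then show ?thesis using assms(1) by (auto intro: int_span_sum int_span_of_int_mult)
qed

text \<open>The elements that multiply the span into itself form a ring, so testing the generators
  is enough.\<close>

lemma int_span_int_adjoin_closed:
  assumes G: "\<And>g v. g \<in> G \<Longrightarrow> v \<in> V \<Longrightarrow> g * v \<in> int_span V"
    and x: "x \<in> int_adjoin G" and y: "y \<in> int_span V"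
  shows "x * y \<in> int_span V"
  using x y
proof (induction arbitrary: y)
  case (gen g)
  then show ?case using G by (auto intro: int_span_mult_closed)
next
  case (diff u v)
  then show ?case by (auto simp: left_diff_distrib intro: int_span_diff)
qed (auto simp: mult.assoc)

text \<open>\<open>x\<close> is an eigenvalue of the integer matrix of multiplication by \<open>x\<close>.\<close>

lemma algebraic_int_of_int_span:
  fixes x :: "'a :: field_char_0"
  assumes fin: "finite V" and nz: "v0 \<in> V" "v0 \<noteq> 0"
    and cl: "\<And>v. v \<in> V \<Longrightarrow> x * v \<in> int_span V"
  shows "algebraic_int x"
proof -
  let ?k = "card V"
  obtain e where e: "bij_betw e {..<?k} V"
    using fin ex_bij_betw_nat_finite[OF fin] by (auto simp: lessThan_atLeast0)
  have "\<forall>v\<in>V. \<exists>c. x * v = (\<Sum>w\<in>V. of_int (c w) * w)"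
    using cl unfolding int_span_def by blast
  then obtain c :: "'a \<Rightarrow> 'a \<Rightarrow> int" where c: "\<And>v. v \<in> V \<Longrightarrow> x * v = (\<Sum>w\<in>V. of_int (c v w) * w)"
    by metis
  define A where "A = mat ?k ?k (\<lambda>(i, j). c (e i) (e j))"
  define B where "B = map_mat (of_int :: int \<Rightarrow> 'a) A"
  have A: "A \<in> carrier_mat ?k ?k" and B: "B \<in> carrier_mat ?k ?k"
    by (auto simp: A_def B_def)
  \<comment> \<open>The eigenvector lists the elements of \<open>V\<close>; the entry
    \<open>v0\<close> makes it nonzero.\<close>
  define u where "u = vec ?k e"
  have "eigenvector B u x"
    unfolding eigenvector_def
  proof (intro conjI)
    show "u \<in> carrier_vec (dim_row B)" using B by (auto simp: u_def)
    obtain i where i: "i < ?k" "e i = v0" using e nz(1) by (metis bij_betw_iff_bijections lessThan_iff)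
    then have "u $ i \<noteq> 0" using nz by (simp add: u_def)
    then show "u \<noteq> 0\<^sub>v (dim_row B)" using B i by auto
    show "B *\<^sub>v u = x \<cdot>\<^sub>v u"
    proof (rule eq_vecI)
      fix i assume "i < dim_vec (x \<cdot>\<^sub>v u)"
      then have i: "i < ?k" by (simp add: u_def)
      then have ei: "e i \<in> V" using e by (auto simp: bij_betw_def)
      have "(B *\<^sub>v u) $ i = (\<Sum>j<?k. of_int (c (e i) (e j)) * e j)"
        using i by (simp add: B_def A_def u_def scalar_prod_def lessThan_atLeast0)
      also have "\<dots> = (\<Sum>w\<in>V. of_int (c (e i) w) * w)"
        using sum.reindex_bij_betw[OF e] .
      also have "\<dots> = x * e i" using c[OF ei] by simp
      finally show "(B *\<^sub>v u) $ i = (x \<cdot>\<^sub>v u) $ i" using i by (simp add: u_def)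
    qed (use B in \<open>auto simp: u_def\<close>)
  qed
  then have "poly (char_poly B) x = 0"
    using eigenvalue_root_char_poly[OF B] by (auto simp: eigenvalue_def)
  moreover have "char_poly B = map_poly of_int (char_poly A)"
    unfolding B_def using of_int_hom.char_poly_hom[OF A] by simp
  moreover have "lead_coeff (char_poly A) = 1"
    using degree_monic_char_poly[OF A] by auto
  ultimately show ?thesis
    unfolding algebraic_int_altdef_ipoly by (intro exI[of _ "char_poly A"]) simp
qed

section \<open>Polynomial expressions of bounded degree and monic equations\<close>

definition low_span :: "'a :: comm_ring_1 set \<Rightarrow> 'a \<Rightarrow> nat \<Rightarrow> 'a set"
  where "low_span A x d = {\<Sum>i<d. c i * x ^ i | c. \<forall>i. c i \<in> A}"

context unital_subring
begin

lemma low_spanI: "y = (\<Sum>i<d. c i * x ^ i) \<Longrightarrow> (\<And>i. c i \<in> R) \<Longrightarrow> y \<in> low_span R x d"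
  unfolding low_span_def by auto

lemma low_span_zero [intro]: "0 \<in> low_span R x d"
  by (rule low_spanI[where c = "\<lambda>_. 0"]) auto

lemma low_span_add:
  assumes "y \<in> low_span R x d" "z \<in> low_span R x d"
  shows "y + z \<in> low_span R x d"
proof -
  obtain c e where "\<forall>i. c i \<in> R" "\<forall>i. e i \<in> R" "y = (\<Sum>i<d. c i * x ^ i)" "z = (\<Sum>i<d. e i * x ^ i)"
    using assms unfolding low_span_def by blast
  then show ?thesis
    by (intro low_spanI[where c = "\<lambda>i. c i + e i"]) (auto simp: sum.distrib algebra_simps)
qed

lemma low_span_uminus:
  assumes "y \<in> low_span R x d"
  shows "- y \<in> low_span R x d"
proof -
  obtain c where "\<forall>i. c i \<in> R" "y = (\<Sum>i<d. c i * x ^ i)"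
    using assms unfolding low_span_def by blast
  then show ?thesis
    by (intro low_spanI[where c = "\<lambda>i. - c i"]) (auto simp: sum_negf)
qed

lemma low_span_sum: "(\<And>i. i \<in> I \<Longrightarrow> f i \<in> low_span R x d) \<Longrightarrow> sum f I \<in> low_span R x d"
  by (induction I rule: infinite_finite_induct) (auto intro: low_span_add)

lemma low_span_monom:
  assumes "a \<in> R" "i < d"
  shows "a * x ^ i \<in> low_span R x d"
  using assms
  by (intro low_spanI[where c = "\<lambda>j. if j = i then a else 0"])
    (auto simp: if_distrib [of "\<lambda>c. c * _"] sum.delta cong: if_cong)

lemma low_span_mono:
  assumes "y \<in> low_span R x d" "d \<le> d'"
  shows "y \<in> low_span R x d'"
proof -
  obtain c where "\<forall>i. c i \<in> R" "y = (\<Sum>i<d. c i * x ^ i)"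
    using assms unfolding low_span_def by blast
  then show ?thesis using assms(2) by (auto intro!: low_span_sum low_span_monom)
qed

lemma low_span_mult:
  assumes "y \<in> low_span R x d" "z \<in> low_span R x d'"
  shows "y * z \<in> low_span R x (d + d')"
proof -
  obtain c e where "\<forall>i. c i \<in> R" "\<forall>i. e i \<in> R" "y = (\<Sum>i<d. c i * x ^ i)" "z = (\<Sum>i<d'. e i * x ^ i)"
    using assms unfolding low_span_def by blast
  moreover have "(\<Sum>i<d. c i * x ^ i) * (\<Sum>i<d'. e i * x ^ i)
      = (\<Sum>i<d. \<Sum>j<d'. (c i * e j) * x ^ (i + j))"
    by (simp add: sum_product power_add algebra_simps)
  ultimately show ?thesis by (auto intro!: low_span_sum low_span_monom)
qed

text \<open>As a polynomial in \<open>x\<close>, the iterate is monic of degree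
  \<open>2 ^ k\<close>. The hypothesis on \<open>b\<close> covers both \<open>b \<in> R\<close> and
  the case \<open>x = b\<close>, where \<open>b\<close> itself has degree 1.\<close>

lemma quad_iter_low_span:
  assumes "b \<in> low_span R x 2"
  shows "(quad b ^^ k) x - x ^ (2 ^ k) \<in> low_span R x (2 ^ k)"
proof (induction k)
  case (Suc k)
  define l where "l = (quad b ^^ k) x - x ^ (2 ^ k)"
  have l: "l \<in> low_span R x (2 ^ k)" using Suc by (simp add: l_def)
  have "2 * x ^ (2 ^ k) * l \<in> low_span R x (2 ^ Suc k)"
  proof -
    obtain c where c: "\<forall>i. c i \<in> R" "l = (\<Sum>i<2 ^ k. c i * x ^ i)"
      using l unfolding low_span_def by blast
    have "2 * x ^ (2 ^ k) * l = (\<Sum>i<2 ^ k. (2 * c i) * x ^ (2 ^ k + i))"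
      unfolding c by (simp add: sum_distrib_left power_add algebra_simps)
    then show ?thesis using c by (auto intro!: low_span_sum low_span_monom)
  qed
  moreover have "l * l \<in> low_span R x (2 ^ Suc k)"
    using low_span_mult[OF l l] by (simp add: mult_2)
  moreover have "b \<in> low_span R x (2 ^ Suc k)"
    by (rule low_span_mono[OF assms]) simp
  ultimately have "2 * x ^ (2 ^ k) * l + l * l + b \<in> low_span R x (2 ^ Suc k)"
    by (intro low_span_add)
  moreover have "x ^ (2 ^ Suc k) = x ^ (2 ^ k) * x ^ (2 ^ k)"
    by (simp add: power_add [symmetric] mult_2)
  then have "(quad b ^^ Suc k) x - x ^ (2 ^ Suc k) = 2 * x ^ (2 ^ k) * l + l * l + b"
    by (simp add: l_def power2_eq_square algebra_simps)
  ultimately show ?case by (simp only:)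
qed auto

end

lemma int_adjoin_mono: "G \<subseteq> H \<Longrightarrow> int_adjoin G \<subseteq> int_adjoin H"
  by (rule int_adjoin.int_adjoin_subset) (auto intro: int_adjoin.gen)

text \<open>The monomials \<open>b ^ i * x ^ j\<close> with \<open>i < p\<close> and
  \<open>j < q\<close> have a \<int>-span stable under \<open>b\<close> and \<open>x\<close>,
  because the two monic relations reduce an exponent that overflows. Every \<open>y\<close> then
  acts on this span.\<close>

lemma int_adjoin_integral:
  fixes b x :: "'a :: field_char_0"
  assumes b: "b ^ p \<in> low_span (int_adjoin {}) b p" and p: "p > 0"
    and x: "x ^ q \<in> low_span (int_adjoin {b}) x q" and q: "q > 0"
    and y: "y \<in> int_adjoin {b, x}"
  shows "algebraic_int y"
proof -
  define V where "V = (\<lambda>(i, j). b ^ i * x ^ j) ` ({..<p} \<times> {..<q})"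
  have V: "b ^ i * x ^ j \<in> V" if "i < p" "j < q" for i j
    using that by (auto simp: V_def intro!: rev_image_eqI[of "(i, j)"])
  have fin: "finite V" by (simp add: V_def)
  note base = int_span_base[OF fin V]
  have bV: "b * v \<in> int_span V" if v: "v \<in> V" for v
  proof -
    obtain i j where ij: "i < p" "j < q" "v = b ^ i * x ^ j" using v by (auto simp: V_def)
    show ?thesis
    proof (cases "Suc i < p")
      case True
      then show ?thesis using base[of "Suc i" j] ij by (simp add: mult.assoc)
    next
      case False
      then have "Suc i = p" using ij by simp
      then have "b * v = b ^ p * x ^ j" using ij by (auto simp: mult.assoc)
      moreover obtain c where c: "\<forall>i. c i \<in> int_adjoin {}" "b ^ p = (\<Sum>i<p. c i * b ^ i)"
        using b unfolding low_span_def by blast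
      ultimately have "b * v = (\<Sum>i<p. c i * (b ^ i * x ^ j))"
        by (simp add: sum_distrib_right mult.assoc)
      then show ?thesis
        using c(1) base ij(2)
        by (auto intro!: int_span_sum int_span_int_adjoin_closed[where G = "{}" and y = "_ * _"])
    qed
  qed
  have xV: "x * v \<in> int_span V" if v: "v \<in> V" for v
  proof -
    obtain i j where ij: "i < p" "j < q" "v = b ^ i * x ^ j" using v by (auto simp: V_def)
    show ?thesis
    proof (cases "Suc j < q")
      case True
      then show ?thesis using base[of i "Suc j"] ij by (simp add: algebra_simps)
    next
      case False
      then have "Suc j = q" using ij by simp
      then have "x * v = x ^ q * b ^ i" using ij by (auto simp: algebra_simps)
      moreover obtain c where c: "\<forall>i. c i \<in> int_adjoin {b}" "x ^ q = (\<Sum>j<q. c j * x ^ j)"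
        using x unfolding low_span_def by blast
      ultimately have "x * v = (\<Sum>j<q. c j * (b ^ i * x ^ j))"
        by (simp add: sum_distrib_left algebra_simps)
      then show ?thesis
        using c(1) base ij(1) bV
        by (auto intro!: int_span_sum int_span_int_adjoin_closed[where G = "{b}" and y = "_ * _"])
    qed
  qed
  show ?thesis
  proof (rule algebraic_int_of_int_span[OF fin])
    show "1 \<in> V" using V[OF p q] by simp
    show "y * v \<in> int_span V" if "v \<in> V" for v
      by (rule int_span_int_adjoin_closed[OF _ y int_span_base[OF fin that]]) (use bV xV in auto)
  qed simp
qed

text \<open>\<open>b\<close> satisfies a monic equation over \<int> because the iterate
  \<open>n - 1\<close> of \<open>b\<close> is the iterate \<open>n\<close> of 0. Equating the
  iterates \<open>k\<close> and \<open>l\<close> of \<open>x\<close> is a monic equation of degree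
  \<open>2 ^ k\<close> over \<int>[b].\<close>

lemma int_adjoin_quad_integral:
  fixes b x :: "'a :: field_char_0"
  assumes n: "(quad b ^^ n) 0 = 0" "n > 0"
    and x: "(quad b ^^ k) x = (quad b ^^ l) x" "l < k"
    and y: "y \<in> int_adjoin {b, x}"
  shows "algebraic_int y"
proof -
  let ?F = "quad b"
  obtain m where m: "n = Suc m" using n(2) by (cases n) auto
  have "(?F ^^ m) b = 0"
    using n(1) by (simp add: m funpow_Suc_right del: funpow.simps)
  moreover have "b \<in> low_span (int_adjoin {}) b 2"
    using int_adjoin.low_span_monom[of 1 "{}" 1 2 b] by simp
  ultimately have "- (b ^ (2 ^ m)) \<in> low_span (int_adjoin {}) b (2 ^ m)"
    using int_adjoin.quad_iter_low_span[of b "{}" b m] by simp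
  then have bm: "b ^ (2 ^ m) \<in> low_span (int_adjoin {}) b (2 ^ m)"
    using int_adjoin.low_span_uminus by fastforce
  let ?L = "low_span (int_adjoin {b}) x"
  have b2: "b \<in> ?L 2"
    using int_adjoin.low_span_monom[of b "{b}" 0 2 x] by (simp add: int_adjoin.gen)
  have lt: "(2 :: nat) ^ l < 2 ^ k" using x(2) by simp
  have "(?F ^^ l) x - x ^ (2 ^ l) \<in> ?L (2 ^ k)"
    using int_adjoin.low_span_mono[OF int_adjoin.quad_iter_low_span[OF b2]] lt by simp
  moreover have "x ^ (2 ^ l) \<in> ?L (2 ^ k)"
    using int_adjoin.low_span_monom[of 1 "{b}" "2 ^ l" "2 ^ k" x] lt by simp
  ultimately have "((?F ^^ l) x - x ^ (2 ^ l)) + x ^ (2 ^ l) \<in> ?L (2 ^ k)"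
    by (rule int_adjoin.low_span_add)
  then have "(?F ^^ k) x \<in> ?L (2 ^ k)" using x by simp
  moreover have "- ((?F ^^ k) x - x ^ (2 ^ k)) \<in> ?L (2 ^ k)"
    by (rule int_adjoin.low_span_uminus[OF int_adjoin.quad_iter_low_span[OF b2]])
  ultimately have "(?F ^^ k) x + - ((?F ^^ k) x - x ^ (2 ^ k)) \<in> ?L (2 ^ k)"
    by (rule int_adjoin.low_span_add)
  then have "x ^ (2 ^ k) \<in> ?L (2 ^ k)" by simp
  then show ?thesis using int_adjoin_integral[OF bm _ _ _ y] by simp
qed

section \<open>Rings on which a power of Frobenius is the identity modulo 2\<close>

locale frobenius_subring = unital_subring R for R :: "'a :: field_char_0 set" +
  fixes q :: nat
  assumes q: "q \<ge> 2"
    and frobenius: "\<And>x. x \<in> R \<Longrightarrow> cong2 (x ^ q) x"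
    and integral: "\<And>x. x \<in> R \<Longrightarrow> algebraic_int x"
begin

lemma poly_of_int_mem: "x \<in> R \<Longrightarrow> poly (map_poly of_int p) x \<in> R"
  by (induction p) (auto simp: map_poly_pCons)

text \<open>The constant term of an integer polynomial killing \<open>x\<close> is a multiple of \<open>x\<close>, hence
  would be a rational integer divisible by every power of 2.\<close>

lemma infinitely_even_eq_0:
  assumes x: "x \<in> R" and ev: "\<And>k. \<exists>y\<in>R. x = 2 ^ k * y"
  shows "x = 0"
proof (rule ccontr)
  assume nz: "x \<noteq> 0"
  have no_root: "p = 0" if "poly (map_poly of_int p) x = 0" for p :: "int poly"
    using that
  proof (induction p)
    case (pCons a p)
    let ?w = "poly (map_poly of_int p) x"
    have eq: "of_int a + x * ?w = 0" using pCons by (simp add: map_poly_pCons)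
    show ?case
    proof (cases "a = 0")
      case True
      then show ?thesis using eq nz pCons by simp
    next
      case False
      \<comment> \<open>With this \<open>k\<close> the power \<open>2 ^ k\<close> exceeds the
        absolute value of \<open>a\<close>, so it cannot divide a nonzero \<open>a\<close>.\<close>
      define k where "k = nat \<bar>a\<bar>"
      obtain y where y: "y \<in> R" "x = 2 ^ k * y" using ev by blast
      have "of_int a = 2 ^ k * (- y * ?w)" using eq y by (simp add: algebra_simps eq_neg_iff_add_eq_0)
      then have z: "- y * ?w = of_int a / 2 ^ k" by (simp add: field_simps)
      have "- y * ?w \<in> R" using x y poly_of_int_mem by auto
      then have "algebraic_int (- y * ?w)" by (rule integral)
      then have "of_int a / 2 ^ k \<in> (\<int> :: 'a set)"
        unfolding z by (rule rational_algebraic_int_is_int) auto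
      then obtain c where "(of_int a :: 'a) = of_int c * 2 ^ k"
        by (auto elim!: Ints_cases simp: field_simps)
      then have "(of_int a :: 'a) = of_int (c * 2 ^ k)" by simp
      then have ac: "a = c * 2 ^ k" by (simp only: of_int_eq_iff)
      then have "2 ^ k \<le> \<bar>a\<bar>" using False by (auto simp: abs_mult)
      moreover have "int k < 2 ^ k" by (rule of_nat_less_two_power)
      ultimately show ?thesis by (simp add: k_def)
    qed
  qed simp
  obtain p where "poly (map_poly of_int p) x = 0" "lead_coeff p = 1"
    using integral[OF x] unfolding algebraic_int_altdef_ipoly by blast
  then show False using no_root[of p] by force
qed

text \<open>\<open>R / 2R\<close> is reduced: \<open>x\<close> is congruent to its power
  \<open>x ^ (q ^ r)\<close>, whose exponent exceeds \<open>r\<close>.\<close>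

lemma cong2_nilpotent:
  assumes x: "x \<in> R" and "cong2 (x ^ r) 0"
  shows "cong2 x 0"
proof -
  have pow: "cong2 (x ^ (q ^ j)) x" for j
  proof (induction j)
    case (Suc j)
    have "cong2 ((x ^ (q ^ j)) ^ q) (x ^ q)" using Suc x by (rule cong2_power)
    also have "cong2 \<dots> x" using x by (rule frobenius)
    finally show ?case by (simp add: power_mult [symmetric] mult.commute)
  qed auto
  have "r < 2 ^ r" by (rule less_exp)
  also have "\<dots> \<le> q ^ r" using q by (rule power_mono) simp
  finally have "x ^ (q ^ r) = x ^ r * x ^ (q ^ r - r)"
    by (simp add: power_add [symmetric])
  moreover have "cong2 (x ^ r * x ^ (q ^ r - r)) (0 * x ^ (q ^ r - r))"
    using assms by (intro cong2_mult) auto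
  ultimately have "cong2 (x ^ (q ^ r)) 0" by simp
  then show ?thesis using pow[of r] cong2_sym cong2_trans by blast
qed

text \<open>Multiplying a monic equation of degree \<open>r\<close> for \<open>y\<close> by
  \<open>2 ^ r\<close> puts \<open>x ^ r\<close> into \<open>2R\<close>, and \<open>R / 2R\<close>
  is reduced. In effect \<open>R\<close> is integrally closed at 2.\<close>

lemma cong2_of_algebraic_int:
  assumes x: "x \<in> R" "x = 2 * y" and y: "algebraic_int y"
  shows "cong2 x 0"
proof -
  obtain p where p: "poly (map_poly of_int p) y = 0" "lead_coeff p = 1"
    using y unfolding algebraic_int_altdef_ipoly by blast
  let ?r = "degree p"
  have "0 = (\<Sum>i\<le>?r. of_int (coeff p i) * y ^ i)"
    using p(1) by (simp add: poly_altdef)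
  also have "\<dots> = (\<Sum>i<?r. of_int (coeff p i) * y ^ i) + y ^ ?r"
    using p(2) by (simp add: lessThan_Suc_atMost [symmetric])
  finally have yr: "y ^ ?r = - (\<Sum>i<?r. of_int (coeff p i) * y ^ i)"
    by (simp add: eq_neg_iff_add_eq_0 add.commute)
  have "x ^ ?r = 2 ^ ?r * y ^ ?r" by (simp add: x power_mult_distrib)
  also have "\<dots> = - (\<Sum>i<?r. 2 ^ ?r * (of_int (coeff p i) * y ^ i))"
    unfolding yr by (simp add: sum_distrib_left)
  also have "(\<Sum>i<?r. 2 ^ ?r * (of_int (coeff p i) * y ^ i))
      = (\<Sum>i<?r. 2 * (of_int (coeff p i) * 2 ^ (?r - 1 - i) * x ^ i))"
  proof (rule sum.cong)
    fix i assume "i \<in> {..<?r}"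
    then have "?r = Suc (?r - 1 - i + i)" by auto
    \<comment> \<open>One factor 2 is left over because \<open>i < r\<close>; the factor
      \<open>2 ^ i\<close> turns \<open>y ^ i\<close> into \<open>x ^ i\<close>.\<close>
    then have "(2 :: 'a) ^ ?r = 2 * 2 ^ (?r - 1 - i) * 2 ^ i"
      by (metis power_Suc power_add mult.assoc)
    then show "2 ^ ?r * (of_int (coeff p i) * y ^ i)
        = 2 * (of_int (coeff p i) * 2 ^ (?r - 1 - i) * x ^ i)"
      by (simp add: x power_mult_distrib)
  qed simp
  finally have "x ^ ?r = 0 + 2 * - (\<Sum>i<?r. of_int (coeff p i) * 2 ^ (?r - 1 - i) * x ^ i)"
    by (simp add: sum_distrib_left)
  moreover have "- (\<Sum>i<?r. of_int (coeff p i) * 2 ^ (?r - 1 - i) * x ^ i) \<in> R"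
    using x(1) by (intro uminus_mem sum_mem mult_mem power_mem) auto
  ultimately have "cong2 (x ^ ?r) 0" unfolding cong2_def by blast
  then show ?thesis by (rule cong2_nilpotent[OF x(1)])
qed

end

lemma frobenius_subring_int_adjoin:
  fixes b y :: "'a :: field_char_0"
  assumes n: "(quad b ^^ n) 0 = 0" "n > 0" and N: "(quad b ^^ N) y = y" "N > 0"
  shows "frobenius_subring (int_adjoin {b, y}) (2 ^ (n * N))"
proof
  show "2 \<le> (2 :: nat) ^ (n * N)" using n N by (intro self_le_power) auto
  show "algebraic_int x" if "x \<in> int_adjoin {b, y}" for x
    using int_adjoin_quad_integral[OF n, of N y 0] N that by simp
  show "int_adjoin.cong2 {b, y} (x ^ 2 ^ (n * N)) x" if "x \<in> int_adjoin {b, y}" for x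
    using int_adjoin_frobenius[OF n(1) N(1) that] .
qed

section \<open>Conjugates of a periodic point\<close>

lemma funpow_fixed_funpow:
  assumes "(f ^^ N) x = x"
  shows "(f ^^ N) ((f ^^ k) x) = (f ^^ k) x"
proof -
  have "(f ^^ N) ((f ^^ k) x) = (f ^^ (k + N)) x"
    by (simp add: funpow_add add.commute [of k])
  then show ?thesis using assms by (simp add: funpow_add)
qed

lemma power_fun_apply: "(s ^ k) t = (s t :: 'a :: comm_ring_1) ^ k"
  by (induction k) auto

lemma quad_iter_fun_apply: "(quad B ^^ k) Y t = (quad (B t) ^^ k) (Y t :: 'a :: comm_ring_1)"
  by (induction k) (auto simp: power_fun_apply)

text \<open>
  \<open>S\<close> is the ring of all pairs \<open>(g(b, \<beta>), g(b, F\<^sup>n(\<beta>)))\<close> with \<open>g \<in> \<int>[X, Y]\<close>, as functions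
  on \<^typ>\<open>bool\<close>. If \<open>(0, x) \<in> S\<close>, then \<open>x\<close> is even because \<open>F\<^sup>n\<close> is a Frobenius power; and as
  \<open>s^q = s + 2t\<close> with \<open>t = (0, y) \<in> S\<close>, divisibility of all such \<open>x\<close> by \<open>2^k\<close> improves to \<open>2^(k+1)\<close>.
\<close>

lemma quad_iter_conjugate_root:
  fixes b \<beta> :: "'a :: field_char_0"
  assumes n: "(quad b ^^ n) 0 = 0" "n > 0" and N: "(quad b ^^ N) \<beta> = \<beta>" "N > 0"
    and g: "\<And>i. coeff g i \<in> int_adjoin {b}" "poly g \<beta> = 0"
  shows "poly g ((quad b ^^ n) \<beta>) = 0"
proof -
  let ?R = "int_adjoin {b, \<beta>}" and ?q = "2 ^ (n * N)"
  interpret R: frobenius_subring ?R ?q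
    using n N by (rule frobenius_subring_int_adjoin)
  have bR: "b \<in> ?R" "\<beta> \<in> ?R" by (auto intro: int_adjoin.gen)
  define B where "B = (\<lambda>_ :: bool. b)"
  define Y where "Y = (\<lambda>t. if t then \<beta> else (quad b ^^ n) \<beta>)"
  let ?S = "int_adjoin {B, Y}"
  have BS: "B \<in> ?S" "Y \<in> ?S" by (auto intro: int_adjoin.gen)
  \<comment> \<open>Modulo 2 the second component is the \<open>2 ^ n\<close>-th power of the first:
    true for both generators because the iterate \<open>n\<close> of 0 is 0, and inherited by
    differences and products.\<close>
  have S_R: "s True \<in> ?R \<and> s False \<in> ?R \<and> int_adjoin.cong2 {b, \<beta>} (s False) (s True ^ 2 ^ n)"
    if "s \<in> ?S" for s
    using that
  proof induction
    case (gen s)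
    have "int_adjoin.cong2 {b, \<beta>} b (b ^ 2 ^ n)"
      using int_adjoin.quad_iter_frobenius[OF bR(1) bR(1), of n] quad_iter_param[OF n(1)] n
      by simp
    moreover have "int_adjoin.cong2 {b, \<beta>} ((quad b ^^ n) \<beta>) (\<beta> ^ 2 ^ n)"
      using int_adjoin.quad_iter_frobenius[OF bR, of n] n by simp
    moreover have "(quad b ^^ n) \<beta> \<in> ?R"
      using bR by (rule int_adjoin.quad_iter_mem)
    ultimately show ?case using gen bR by (auto simp: B_def Y_def)
  next
    case (diff s s')
    then have "int_adjoin.cong2 {b, \<beta>} (s False - s' False) (s True ^ 2 ^ n - s' True ^ 2 ^ n)"
      by (intro int_adjoin.cong2_diff) auto
    moreover have "int_adjoin.cong2 {b, \<beta>} (s True ^ 2 ^ n - s' True ^ 2 ^ n) ((s True - s' True) ^ 2 ^ n)"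
      using diff by (intro int_adjoin.cong2_sym[OF int_adjoin.cong2_frobenius_diff]) auto
    ultimately have "int_adjoin.cong2 {b, \<beta>} (s False - s' False) ((s True - s' True) ^ 2 ^ n)"
      by (rule int_adjoin.cong2_trans)
    then show ?case using diff by auto
  next
    case (mult s s')
    then have "int_adjoin.cong2 {b, \<beta>} (s False * s' False) (s True ^ 2 ^ n * s' True ^ 2 ^ n)"
      by (intro int_adjoin.cong2_mult) auto
    then show ?case using mult by (auto simp: power_mult_distrib)
  qed auto
  \<comment> \<open>\<open>B\<close> and \<open>Y\<close> satisfy the equations of \<open>b\<close>
    and \<beta> pointwise, so \<open>int_adjoin_frobenius\<close> applies in the ring of
    functions.\<close>
  have nB: "(quad B ^^ n) 0 = 0"
    using n by (auto simp: fun_eq_iff quad_iter_fun_apply B_def)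
  have "(quad b ^^ N) ((quad b ^^ n) \<beta>) = (quad b ^^ n) \<beta>"
    by (rule funpow_fixed_funpow[OF N(1)])
  then have NY: "(quad B ^^ N) Y = Y"
    using N by (auto simp: fun_eq_iff quad_iter_fun_apply B_def Y_def)
  have ker: "\<exists>y\<in>?R. s False = 2 ^ Suc k * y" if "s \<in> ?S" "s True = 0" for s k
    using that
  proof (induction k arbitrary: s)
    case 0
    then have "int_adjoin.cong2 {b, \<beta>} (s False) 0"
      using S_R[of s] by (simp add: power_0_left)
    then show ?case by (simp add: int_adjoin.cong2_def)
  next
    case (Suc k)
    obtain t where t: "t \<in> ?S" "s ^ ?q = s + 2 * t"
      using int_adjoin_frobenius[OF nB NY Suc.prems(1)] by (auto simp: int_adjoin.cong2_def)
    have st: "s i ^ ?q = s i + 2 * t i" for i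
      using fun_cong[OF t(2), of i] by (simp add: power_fun_apply)
    have "t True = 0" using st[of True] Suc.prems by (simp add: power_0_left)
    then obtain y where y: "y \<in> ?R" "t False = 2 ^ Suc k * y" using Suc.IH[OF t(1)] by blast
    obtain z where z: "z \<in> ?R" "s False = 2 ^ Suc k * z" using Suc.IH[OF Suc.prems] by blast
    \<comment> \<open>Since \<open>q \<ge> 2\<close>, the power contains \<open>s False\<close>
      twice and is divisible by \<open>2 ^ (2 * k + 2)\<close>; the term \<open>2 * t False\<close>
      has one factor 2 more than the induction hypothesis gives for \<open>t\<close>.\<close>
    have "?q = Suc (Suc (?q - 2))" using R.q by simp
    then have "s False ^ ?q = s False * s False * s False ^ (?q - 2)"
      by (metis power_Suc mult.assoc)
    also have "\<dots> = 2 ^ Suc (Suc k) * (2 ^ k * z * z * s False ^ (?q - 2))"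
      using z(2) by simp
    finally have "s False = 2 ^ Suc (Suc k) * (2 ^ k * z * z * s False ^ (?q - 2) - y)"
      using st[of False] y(2) by (simp add: algebra_simps)
    moreover have "2 ^ k * z * z * s False ^ (?q - 2) - y \<in> ?R"
      using y(1) z(1) S_R[OF Suc.prems(1)]
      by (intro int_adjoin.diff_mem int_adjoin.mult_mem int_adjoin.power_mem int_adjoin.numeral_mem) auto
    ultimately show ?case by blast
  qed
  have const: "(\<lambda>_. c) \<in> ?S" if "c \<in> int_adjoin {b}" for c
    using that
  proof induction
    case one
    then show ?case using int_adjoin.one[of "{B, Y}"] by (simp add: one_fun_def)
  next
    case (gen c)
    then show ?case using BS by (simp add: B_def)
  next
    case (diff c d)
    then show ?case using int_adjoin.diff[OF diff.IH] by (simp add: fun_diff_def)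
  next
    case (mult c d)
    then show ?case using int_adjoin.mult[OF mult.IH] by (simp add: times_fun_def)
  qed
  \<comment> \<open>This is the pair of values of \<open>g\<close> at \<beta> and at its iterate;
    the first component is 0.\<close>
  have "(\<lambda>t. poly g (Y t)) \<in> ?S"
    using g(1)
  proof (induction g)
    case 0
    then show ?case using int_adjoin.zero_mem[of "{B, Y}"] by (simp add: zero_fun_def)
  next
    case (pCons a g)
    have "coeff g i \<in> int_adjoin {b}" for i using pCons.prems[of "Suc i"] by simp
    then have "(\<lambda>t. poly g (Y t)) \<in> ?S" by (rule pCons.IH)
    moreover have "(\<lambda>_. a) \<in> ?S" using pCons.prems[of 0] by (intro const) simp
    ultimately have "(\<lambda>_. a) + Y * (\<lambda>t. poly g (Y t)) \<in> ?S"
      using BS by auto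
    then show ?case by (simp add: plus_fun_def times_fun_def)
  qed
  from ker[OF this] have ev: "\<exists>y\<in>?R. poly g (Y False) = 2 ^ Suc k * y" for k
    using g(2) by (simp add: Y_def)
  have "\<exists>y\<in>?R. poly g (Y False) = 2 ^ k * y" for k
  proof -
    obtain y where "y \<in> ?R" "poly g (Y False) = 2 ^ Suc k * y" using ev by blast
    then show ?thesis by (intro bexI[of _ "2 * y"]) auto
  qed
  moreover have "poly g (Y False) \<in> ?R" using calculation[of 0] by auto
  ultimately have "poly g (Y False) = 0" by (rule R.infinitely_even_eq_0[rotated])
  then show ?thesis by (simp add: Y_def)
qed

section \<open>Nonzero periodic points as units\<close>

lemma (in unital_subring) quad_iter_diff_critical:
  assumes "b \<in> R" "x \<in> R"
  shows "\<exists>h\<in>R. (quad b ^^ Suc k) x - (quad b ^^ Suc k) 0 = x\<^sup>2 * h"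
proof (induction k)
  case 0
  \<comment> \<open>The square originates here, from 0 being critical; each further step only
    multiplies by a sum of two iterates.\<close>
  show ?case by (rule bexI[of _ 1]) auto
next
  case (Suc k)
  then obtain h where h: "h \<in> R" "(quad b ^^ Suc k) x - (quad b ^^ Suc k) 0 = x\<^sup>2 * h" by blast
  let ?s = "(quad b ^^ Suc k) x + (quad b ^^ Suc k) 0"
  have "(quad b ^^ Suc (Suc k)) x - (quad b ^^ Suc (Suc k)) 0
      = ((quad b ^^ Suc k) x - (quad b ^^ Suc k) 0) * ?s"
    by (simp only: funpow.simps(2) [of "Suc k"] comp_apply) (simp add: power2_eq_square algebra_simps)
  also have "\<dots> = x\<^sup>2 * (h * ?s)" by (simp only: h(2) mult.assoc)
  finally show ?case
    using h(1) assms by (intro bexI[of _ "h * ?s"]) (auto intro!: quad_iter_mem simp del: funpow.simps)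
qed

text \<open>After \<open>n * N\<close> steps both 0 and \<beta> return, so \<beta> is a multiple of
  its own square; cancelling \<beta> exhibits the inverse.\<close>

lemma quad_periodic_unit:
  fixes b \<beta> :: "'a :: field_char_0"
  assumes n: "(quad b ^^ n) 0 = 0" "n > 0" and N: "(quad b ^^ N) \<beta> = \<beta>" "N > 0" and "\<beta> \<noteq> 0"
  shows "\<exists>\<delta>\<in>int_adjoin {b, \<beta>}. \<delta> * \<beta> = 1"
proof -
  obtain k where k: "n * N = Suc k" using n N by (metis gr0_conv_Suc nat_0_less_mult_iff)
  have "(quad b ^^ Suc k) 0 = 0" unfolding k [symmetric] using n(1) by (rule funpow_fixed_mult)
  moreover have "(quad b ^^ Suc k) \<beta> = \<beta>"
    unfolding k [symmetric] mult.commute[of n] using N(1) by (rule funpow_fixed_mult)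
  ultimately obtain h where "h \<in> int_adjoin {b, \<beta>}" "\<beta> = \<beta>\<^sup>2 * h"
    using int_adjoin.quad_iter_diff_critical[of b "{b, \<beta>}" \<beta> k]
    by (auto intro: int_adjoin.gen)
  then show ?thesis using \<open>\<beta> \<noteq> 0\<close> by (intro bexI[of _ h]) (auto simp: power2_eq_square mult.commute)
qed

section \<open>The Eisenstein argument\<close>

text \<open>Modulo 2 only the Frobenius term remains. The correction also keeps the factor
  \<open>x - y\<close>, which gives the Eisenstein shape used below.\<close>

lemma (in unital_subring) quad_iter_diff:
  assumes "b \<in> R" "x \<in> R" "y \<in> R"
  shows "\<exists>s\<in>R. (quad b ^^ k) x - (quad b ^^ k) y = (x - y) ^ (2 ^ k) + 2 * (x - y) * s"
proof (induction k)
  case 0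
  show ?case by (rule bexI[of _ 0]) auto
next
  case (Suc k)
  define u where "u = x - y"
  define z where "z = (quad b ^^ k) y"
  have uz: "u \<in> R" "z \<in> R" using assms by (auto simp: u_def z_def intro: quad_iter_mem)
  obtain s where s: "s \<in> R" "(quad b ^^ k) x = z + u ^ (2 ^ k) + 2 * u * s"
    using Suc by (auto simp: u_def z_def algebra_simps)
  \<comment> \<open>The exponent is positive, so the cross term \<open>2 * z * u ^ (2 ^ k)\<close>
    still contains a factor \<open>u\<close>.\<close>
  have "(2 :: nat) ^ k = Suc (2 ^ k - 1)" by simp
  then have up: "u ^ (2 ^ k) = u * u ^ (2 ^ k - 1)" by (metis power_Suc)
  have u2: "u ^ (2 ^ Suc k) = u ^ (2 ^ k) * u ^ (2 ^ k)"
    by (simp add: power_add [symmetric] mult_2)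
  define t where "t = 2 * s * u ^ (2 ^ k) + 2 * u * s * s + z * u ^ (2 ^ k - 1) + 2 * z * s"
  have "(quad b ^^ Suc k) x - (quad b ^^ Suc k) y = (z + u ^ (2 ^ k) + 2 * u * s)\<^sup>2 - z\<^sup>2"
    using s(2) by (simp add: z_def)
  also have "\<dots> = u ^ (2 ^ k) * u ^ (2 ^ k) + 2 * z * u ^ (2 ^ k)
      + 2 * u * (2 * s * u ^ (2 ^ k) + 2 * u * s * s + 2 * z * s)"
    by (simp add: power2_eq_square algebra_simps)
  also have "2 * z * u ^ (2 ^ k) = 2 * u * (z * u ^ (2 ^ k - 1))"
    by (subst up) (simp only: ac_simps)
  finally have "(quad b ^^ Suc k) x - (quad b ^^ Suc k) y = u ^ (2 ^ Suc k) + 2 * u * t"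
    unfolding u2 by (simp add: t_def algebra_simps)
  moreover have "t \<in> R" unfolding t_def using uz s(1)
    by (intro add_mem mult_mem power_mem numeral_mem)
  ultimately show ?case unfolding u_def by blast
qed

text \<open>\<open>power_u\<close> reads \<open>u ^ M + 2 * u * s + 2 * \<beta> = 0\<close> with
  \<beta> a unit of \<open>R\<close>. Keeping \<open>s\<close> as an element of \<open>S\<close>
  avoids writing out the middle coefficients.\<close>

locale eisenstein = frobenius_subring R q for R :: "'a :: field_char_0 set" and q +
  fixes S :: "'a set" and u \<beta> s :: 'a and M :: nat
  assumes S: "unital_subring S" and R_S: "R \<subseteq> S"
    and S_integral: "\<And>y. y \<in> S \<Longrightarrow> algebraic_int y"
    and u: "u \<in> S" and s: "s \<in> S"
    and \<beta>: "\<beta> \<in> R" "\<exists>\<delta>\<in>R. \<delta> * \<beta> = 1"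
    and power_u: "u ^ M = 2 * (- \<beta> - u * s)"
begin

interpretation S: unital_subring S by (rule S)

text \<open>Multiplying the relation by \<open>u^(M-k)\<close> and cancelling 2 shows that the \<open>k\<close>-th coefficient
  lies in \<open>uS\<close>, so its \<open>M\<close>-th power lies in \<open>u^M S \<subseteq> 2S\<close>.\<close>

lemma coeff_even:
  assumes g: "\<And>i. coeff g i \<in> R" "poly g u = 0" "degree g < M"
  shows "cong2 (coeff g k) 0"
proof (induction k rule: less_induct)
  case (less k)
  show ?case
  proof (cases "k < M")
    case False
    then show ?thesis using g(3) by (simp add: coeff_eq_0)
  next
    case True
    define w where "w = - \<beta> - u * s"
    have w: "w \<in> S" using \<beta> R_S u s by (auto simp: w_def)
    have "\<forall>i\<in>{..<k}. \<exists>r\<in>R. coeff g i = 2 * r" using less by (auto simp: cong2_def)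
    then obtain c where c: "\<And>i. i < k \<Longrightarrow> c i \<in> R \<and> coeff g i = 2 * c i"
      by (metis lessThan_iff)
    \<comment> \<open>After multiplication by \<open>u ^ (M - k)\<close> the terms below
      \<open>k\<close> sum to \<open>2 * u * P\<close> and those above to
      \<open>Q * u * u ^ M\<close>; as \<open>u ^ M = 2 * w\<close>, a factor 2 comes out of
      everything.\<close>
    define P where "P = (\<Sum>i<k. c i * u ^ (i + (M - k - 1)))"
    define Q where "Q = (\<Sum>i\<in>{k<..<M}. coeff g i * u ^ (i - k - 1))"
    have "P \<in> S" unfolding P_def using c R_S u by (intro S.sum_mem S.mult_mem S.power_mem) auto
    have "Q \<in> S" unfolding Q_def using g R_S u by (intro S.sum_mem S.mult_mem S.power_mem) auto
    have "0 = (\<Sum>i<M. coeff g i * u ^ i)"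
    proof -
      have "(\<Sum>i\<le>degree g. coeff g i * u ^ i) = (\<Sum>i<M. coeff g i * u ^ i)"
        using g(3) by (intro sum.mono_neutral_left) (auto simp: coeff_eq_0)
      then show ?thesis using g(2) by (simp add: poly_altdef)
    qed
    also have "{..<M} = {..<k} \<union> ({k} \<union> {k<..<M})" using True by auto
    also have "(\<Sum>i\<in>\<dots>. coeff g i * u ^ i)
        = (\<Sum>i<k. coeff g i * u ^ i) + (coeff g k * u ^ k + (\<Sum>i\<in>{k<..<M}. coeff g i * u ^ i))"
      by (subst sum.union_disjoint; (subst sum.union_disjoint)?) auto
    finally have "0 * u ^ (M - k) = ((\<Sum>i<k. coeff g i * u ^ i)
        + (coeff g k * u ^ k + (\<Sum>i\<in>{k<..<M}. coeff g i * u ^ i))) * u ^ (M - k)"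
      by (rule arg_cong)
    also have "\<dots> = (\<Sum>i<k. coeff g i * u ^ i) * u ^ (M - k) + coeff g k * (u ^ k * u ^ (M - k))
        + (\<Sum>i\<in>{k<..<M}. coeff g i * u ^ i) * u ^ (M - k)"
      by (simp add: algebra_simps)
    also have "(\<Sum>i<k. coeff g i * u ^ i) * u ^ (M - k) = 2 * u * P"
      unfolding P_def sum_distrib_right sum_distrib_left
    proof (rule sum.cong)
      fix i assume "i \<in> {..<k}"
      then have ci: "coeff g i = 2 * c i" using c by auto
      have "i + (M - k) = Suc (i + (M - k - 1))" using True by auto
      then have "u ^ i * u ^ (M - k) = u * u ^ (i + (M - k - 1))"
        by (metis power_Suc power_add)
      then show "coeff g i * u ^ i * u ^ (M - k) = 2 * u * (c i * u ^ (i + (M - k - 1)))"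
        unfolding ci by (simp add: algebra_simps)
    qed simp
    also have "(\<Sum>i\<in>{k<..<M}. coeff g i * u ^ i) * u ^ (M - k) = Q * u * u ^ M"
      unfolding Q_def sum_distrib_right
    proof (rule sum.cong)
      fix i assume "i \<in> {k<..<M}"
      then have "i + (M - k) = (i - k - 1) + 1 + M" by auto
      then have "u ^ i * u ^ (M - k) = u ^ (i - k - 1) * u * u ^ M"
        by (metis power_add power_one_right)
      then show "coeff g i * u ^ i * u ^ (M - k) = coeff g i * u ^ (i - k - 1) * u * u ^ M"
        by (simp add: algebra_simps)
    qed simp
    also have "u ^ k * u ^ (M - k) = u ^ M" using True by (simp add: power_add [symmetric])
    also have "u ^ M = 2 * w" using power_u by (simp add: w_def)
    finally have "2 * (u * P + coeff g k * w + Q * u * w) = 0"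
      by (simp add: algebra_simps)
    then have "u * P + coeff g k * w + Q * u * w = 0" unfolding mult_eq_0_iff by simp
    then have "coeff g k * \<beta> = u * (P + Q * w - coeff g k * s)"
      by (simp add: w_def algebra_simps)
    moreover obtain \<delta> where \<delta>: "\<delta> \<in> R" "\<delta> * \<beta> = 1" using \<beta>(2) by blast
    ultimately have "coeff g k = u * (\<delta> * (P + Q * w - coeff g k * s))"
      by (metis mult.commute mult.left_commute mult.right_neutral)
    define z where "z = \<delta> * (P + Q * w - coeff g k * s)"
    have z: "coeff g k = u * z" unfolding z_def by fact
    have zS: "z \<in> S" unfolding z_def using \<delta>(1) \<open>P \<in> S\<close> \<open>Q \<in> S\<close> w s g(1)[of k] R_S by auto
    have "coeff g k ^ M = 2 * (w * z ^ M)"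
      unfolding z power_mult_distrib power_u by (simp add: w_def)
    \<comment> \<open>Divisibility by 2 is visible in \<open>S\<close> only; integrality of the
      quotient brings it back to \<open>R\<close>.\<close>
    moreover have "algebraic_int (w * z ^ M)" using w zS by (intro S_integral) auto
    moreover have "coeff g k ^ M \<in> R" using g(1) by auto
    ultimately have "cong2 (coeff g k ^ M) 0" by (intro cong2_of_algebraic_int)
    then show ?thesis by (rule cong2_nilpotent[OF g(1)])
  qed
qed

text \<open>By \<open>coeff_even\<close>, half of \<open>g\<close> satisfies the same hypotheses.
  Repeating this makes the coefficients divisible by every power of 2, hence 0.\<close>

lemma no_small_relation:
  assumes g: "\<And>i. coeff g i \<in> R" "poly g u = 0" "degree g < M"
  shows "g = 0"
proof -
  have "\<exists>y\<in>R. coeff g i = 2 ^ k * y" for i k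
    using g
  proof (induction k arbitrary: g)
    case 0
    then show ?case by auto
  next
    case (Suc k)
    let ?h = "smult (1 / 2) g"
    have "coeff ?h j \<in> R" for j
    proof -
      obtain r where "r \<in> R" "coeff g j = 2 * r"
        using coeff_even[OF Suc.prems] by (auto simp: cong2_def)
      then show ?thesis by simp
    qed
    then have "\<exists>y\<in>R. coeff ?h i = 2 ^ k * y"
      by (rule Suc.IH) (use Suc.prems in auto)
    then show ?case by (auto simp: field_simps)
  qed
  then have "coeff g i = 0" for i using g(1) by (intro infinitely_even_eq_0)
  then show ?thesis by (intro poly_eqI) simp
qed

end

lemma (in unital_subring) coeff_pcompose_mem:
  assumes "\<And>i. coeff p i \<in> R" "\<And>i. coeff r i \<in> R"
  shows "coeff (pcompose p r) i \<in> R"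
  using assms(1)
proof (induction p arbitrary: i)
  case (pCons a p)
  have "coeff p j \<in> R" for j using pCons.prems[of "Suc j"] by simp
  then have "coeff (pcompose p r) j \<in> R" for j by (rule pCons.IH)
  then have "coeff (r * pcompose p r) i \<in> R" using assms(2) by (auto simp: coeff_mult)
  moreover have "coeff [:a:] i \<in> R" using pCons.prems[of 0] by (cases i) auto
  ultimately show ?case by (auto simp: pcompose_pCons simp del: coeff_pCons_0)
qed simp

text \<open>A relation for \<alpha> of degree below \<open>2 ^ m\<close> would translate into one
  for the Eisenstein element \<alpha> - \<alpha>', which \<open>no_small_relation\<close>
  forbids.\<close>

lemma quad_preperiodic_degree:
  fixes b \<alpha> \<beta> :: "'a :: field_char_0"
  assumes n: "(quad b ^^ n) 0 = 0" "n > 0" and N: "(quad b ^^ N) \<beta> = \<beta>" "N > 0" and "\<beta> \<noteq> 0"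
    and \<alpha>: "(quad b ^^ m) \<alpha> = - \<beta>"
    and g: "\<And>i. coeff g i \<in> int_adjoin {b}" "poly g \<alpha> = 0" "g \<noteq> 0"
  shows "2 ^ m \<le> degree g"
proof (rule ccontr)
  assume "\<not> ?thesis"
  then have small: "degree g < 2 ^ m" by simp
  let ?F = "quad b" and ?R = "int_adjoin {b, \<beta>}" and ?S = "int_adjoin {b, \<alpha>}"
  \<comment> \<open>On the cycle, \<open>N * m - m\<close> steps forward amount to \<open>m\<close>
    steps back; the subtraction is exact because \<open>N\<close> is positive.\<close>
  define \<alpha>' where "\<alpha>' = (?F ^^ (N * m - m)) \<beta>"
  have "m \<le> N * m" using N(2) by simp
  have "(?F ^^ m) \<alpha>' = (?F ^^ (m + (N * m - m))) \<beta>"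
    by (simp add: \<alpha>'_def funpow_add)
  also have "\<dots> = \<beta>" using \<open>m \<le> N * m\<close> funpow_fixed_mult[OF N(1)] by simp
  finally have \<alpha>': "(?F ^^ m) \<alpha>' = \<beta>" .
  have bS: "b \<in> ?S" "\<alpha> \<in> ?S" and bR: "b \<in> ?R" "\<beta> \<in> ?R" by (auto intro: int_adjoin.gen)
  have "- (?F ^^ m) \<alpha> \<in> ?S" using bS by (intro int_adjoin.uminus_mem int_adjoin.quad_iter_mem)
  then have "\<beta> \<in> ?S" using \<alpha> by simp
  then have R_S: "?R \<subseteq> ?S" using bS by (intro int_adjoin.int_adjoin_subset) auto
  have \<alpha>'R: "\<alpha>' \<in> ?R" unfolding \<alpha>'_def using bR by (rule int_adjoin.quad_iter_mem)
  then have \<alpha>'S: "\<alpha>' \<in> ?S" using R_S by blast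
  obtain s where s: "s \<in> ?S"
      "(?F ^^ m) \<alpha> - (?F ^^ m) \<alpha>' = (\<alpha> - \<alpha>') ^ (2 ^ m) + 2 * (\<alpha> - \<alpha>') * s"
    using int_adjoin.quad_iter_diff[OF bS \<alpha>'S] by blast
  interpret R: frobenius_subring ?R "2 ^ (n * N)"
    using n N by (rule frobenius_subring_int_adjoin)
  interpret eisenstein ?R "2 ^ (n * N)" ?S "\<alpha> - \<alpha>'" \<beta> s "2 ^ m"
  proof
    show "algebraic_int y" if "y \<in> ?S" for y
    proof (rule int_adjoin_quad_integral[OF n _ _ that])
      \<comment> \<open>-\<beta> and \<beta> have the same image, so one more step puts the orbit of
        \<alpha> on the cycle of \<beta>.\<close>
      have "(?F ^^ Suc m) \<alpha> = ?F \<beta>" using \<alpha> by simp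
      moreover have "(?F ^^ N) (?F \<beta>) = ?F \<beta>" using funpow_fixed_funpow[OF N(1), of 1] by simp
      ultimately show "(?F ^^ (N + Suc m)) \<alpha> = (?F ^^ Suc m) \<alpha>"
        by (simp only: funpow_add comp_apply)
      show "Suc m < N + Suc m" using N(2) by simp
    qed
    show "(\<alpha> - \<alpha>') ^ 2 ^ m = 2 * (- \<beta> - (\<alpha> - \<alpha>') * s)"
      using s(2) \<alpha> \<alpha>' by (simp add: algebra_simps)
    show "\<exists>\<delta>\<in>?R. \<delta> * \<beta> = 1" using n N \<open>\<beta> \<noteq> 0\<close> by (rule quad_periodic_unit)
  qed (use R_S bS bR \<alpha>'S s in auto)
  let ?h = "pcompose g [:\<alpha>', 1:]"
  have "?h = 0"
  proof (rule no_small_relation)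
    have "coeff g i \<in> ?R" for i using g(1) int_adjoin_mono[of "{b}" "{b, \<beta>}"] by blast
    moreover have "coeff [:\<alpha>', 1:] i \<in> ?R" for i
      using \<alpha>'R by (auto simp: coeff_pCons split: nat.splits)
    ultimately show "coeff ?h i \<in> ?R" for i by (rule int_adjoin.coeff_pcompose_mem)
    show "poly ?h (\<alpha> - \<alpha>') = 0" using g(2) by (simp add: poly_pcompose)
    show "degree ?h < 2 ^ m" using small by simp
  qed
  then show False using g(3) by (simp add: pcompose_eq_0_iff)
qed

section \<open>Degrees of number fields\<close>

lemma ring_of_type_algebra_simps [simp]:
  "carrier (ring_of_type_algebra :: 'a :: comm_ring_1 ring) = UNIV"
  "x \<otimes>\<^bsub>ring_of_type_algebra\<^esub> y = (x * y :: 'a)"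
  "x \<oplus>\<^bsub>ring_of_type_algebra\<^esub> y = (x + y :: 'a)"
  "\<one>\<^bsub>ring_of_type_algebra\<^esub> = (1 :: 'a)"
  "\<zero>\<^bsub>ring_of_type_algebra\<^esub> = (0 :: 'a)"
  by (simp_all add: ring_of_type_algebra_def)

lemma ring_of_type_algebra_a_inv [simp]:
  "\<ominus>\<^bsub>ring_of_type_algebra\<^esub> x = - (x :: 'a :: comm_ring_1)"
proof -
  interpret ring "ring_of_type_algebra :: 'a ring" by (rule ring_from_type_algebra)
  show ?thesis by (rule minus_equality) simp_all
qed

lemma ring_of_type_algebra_m_inv [simp]:
  assumes "x \<noteq> 0"
  shows "inv\<^bsub>ring_of_type_algebra\<^esub> x = inverse (x :: 'a :: field)"
proof -
  interpret cring "ring_of_type_algebra :: 'a ring" by (rule cring_from_type_algebra)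
  show ?thesis using assms by (intro comm_inv_char) simp_all
qed

text \<open>Polynomials of \<open>HOL-Algebra\<close> are lists with the leading coefficient first,
  hence the reversal.\<close>

lemma eval_rev_coeffs:
  "ring.eval ring_of_type_algebra (rev (coeffs p)) x = poly p (x :: 'a :: comm_ring_1)"
proof -
  interpret ring "ring_of_type_algebra :: 'a ring" by (rule ring_from_type_algebra)
  show ?thesis
  proof (induction p)
    case (pCons a p)
    then show ?case
      using eval_append_aux[of "rev (coeffs p)" a x] by (simp add: cCons_def mult.commute)
  qed simp
qed

lemma subfield_rat_adjoin: "subfield (rat_adjoin H) ring_of_type_algebra"
proof -
  interpret field "ring_of_type_algebra :: complex ring" by (rule field_from_type_algebra)
  show ?thesis unfolding rat_adjoin_def by (rule generate_field_is_subfield) simp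
qed

lemma rat_adjoin_of_int: "of_int k \<in> rat_adjoin H"
proof -
  have one: "1 \<in> rat_adjoin H" and add: "\<And>x y. x \<in> rat_adjoin H \<Longrightarrow> y \<in> rat_adjoin H \<Longrightarrow> x + y \<in> rat_adjoin H"
    and neg: "\<And>x. x \<in> rat_adjoin H \<Longrightarrow> - x \<in> rat_adjoin H"
    unfolding rat_adjoin_def
    using generate_field.one[of ring_of_type_algebra H] generate_field.eng_add[of _ ring_of_type_algebra H]
      generate_field.a_inv[of _ ring_of_type_algebra H] by simp_all
  have zero: "0 \<in> rat_adjoin H" using add[OF one neg[OF one]] by simp
  have nat: "of_nat i \<in> rat_adjoin H" for i by (induction i) (auto simp: zero intro: add one)
  show ?thesis by (cases k) (auto simp del: of_nat_Suc intro: nat neg)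
qed

lemma algebraic_over_rat_adjoin:
  assumes "algebraic \<alpha>"
  shows "(ring.algebraic ring_of_type_algebra over rat_adjoin H) \<alpha>"
proof -
  interpret field "ring_of_type_algebra :: complex ring" by (rule field_from_type_algebra)
  obtain p :: "complex poly" where p: "\<forall>i. poly.coeff p i \<in> \<int>" "p \<noteq> 0" "poly p \<alpha> = 0"
    using assms unfolding Polynomial.algebraic_def by blast
  show ?thesis
  proof (rule algebraicI)
    show "rev (coeffs p) \<noteq> []" using p by simp
    have "poly.coeff p i \<in> rat_adjoin H" for i
      using p(1) rat_adjoin_of_int by (metis Ints_cases)
    then have "set (coeffs p) \<subseteq> rat_adjoin H" by (auto simp: coeffs_def)
    then show "rev (coeffs p) \<in> carrier (univ_poly ring_of_type_algebra (rat_adjoin H))"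
      using p(2) by (auto simp: univ_poly_def polynomial_def hd_rev last_coeffs_eq_coeff_degree)
    show "ring.eval ring_of_type_algebra (rev (coeffs p)) \<alpha> = \<zero>\<^bsub>ring_of_type_algebra\<^esub>"
      using p(3) by (simp add: eval_rev_coeffs)
  qed
qed

text \<open>Since \<alpha> is algebraic, the ring \<rat>(b)[\<alpha>] is already a field.\<close>

lemma rat_adjoin_insert:
  assumes "algebraic \<alpha>"
  shows "rat_adjoin {b, \<alpha>} = ring.simple_extension ring_of_type_algebra (rat_adjoin {b}) \<alpha>"
proof -
  interpret field "ring_of_type_algebra :: complex ring" by (rule field_from_type_algebra)
  let ?K = "rat_adjoin {b}"
  note K = subfield_rat_adjoin[of "{b}"]
  show ?thesis
  proof
    have "subfield (simple_extension ?K \<alpha>) ring_of_type_algebra"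
      using simple_extension_is_subfield[OF K] algebraic_over_rat_adjoin[OF assms] by simp
    moreover have "b \<in> simple_extension ?K \<alpha>"
      using simple_extension_incl[of ?K \<alpha>] by (auto simp: rat_adjoin_def intro: generate_field.incl)
    moreover have "\<alpha> \<in> simple_extension ?K \<alpha>"
      by (rule simple_extension_mem[OF subfieldE(1)[OF K]]) simp
    ultimately show "rat_adjoin {b, \<alpha>} \<subseteq> simple_extension ?K \<alpha>"
      unfolding rat_adjoin_def[of "{b, \<alpha>}"] by (intro generate_field_min_subfield1) auto
    have "?K \<subseteq> rat_adjoin {b, \<alpha>}"
      unfolding rat_adjoin_def[of "{b}"]
      by (rule generate_field_min_subfield1[OF _ subfield_rat_adjoin])
        (auto simp: rat_adjoin_def intro: generate_field.incl)
    then show "simple_extension ?K \<alpha> \<subseteq> rat_adjoin {b, \<alpha>}"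
      by (rule simple_extension_subring_incl[OF subfieldE(1)[OF subfield_rat_adjoin]])
        (auto simp: rat_adjoin_def intro: generate_field.incl)
  qed
qed

text \<open>Finiteness of the extension makes \<open>ext_degree\<close>, otherwise unspecified, an
  actual dimension.\<close>

lemma dimension_rat_adjoin:
  assumes "algebraic \<alpha>"
  shows "ring.dimension ring_of_type_algebra (ext_degree (rat_adjoin {b, \<alpha>}) (rat_adjoin {b}))
    (rat_adjoin {b}) (rat_adjoin {b, \<alpha>})"
proof -
  interpret field "ring_of_type_algebra :: complex ring" by (rule field_from_type_algebra)
  have "finite_dimension (rat_adjoin {b}) (rat_adjoin {b, \<alpha>})"
    using finite_dimension_simple_extension[OF subfield_rat_adjoin, of \<alpha> "{b}"]
      algebraic_over_rat_adjoin[OF assms] by (simp add: rat_adjoin_insert[OF assms])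
  then show ?thesis
    using finite_dimensionE[OF subfield_rat_adjoin] by (simp add: ext_degree_def over_def)
qed

section \<open>Clearing denominators\<close>

lemma rat_adjoin_fraction:
  assumes "x \<in> rat_adjoin H"
  shows "\<exists>y\<in>int_adjoin H. \<exists>z\<in>int_adjoin H. z \<noteq> 0 \<and> x = y / z"
  using assms unfolding rat_adjoin_def
proof induction
  case one
  show ?case by (rule bexI[of _ 1], rule bexI[of _ 1]) auto
next
  case (incl h)
  then show ?case by (intro bexI[of _ h] bexI[of _ 1]) (auto intro: int_adjoin.gen)
next
  case (a_inv h)
  then obtain y z where "y \<in> int_adjoin H" "z \<in> int_adjoin H" "z \<noteq> 0" "h = y / z" by blast
  then show ?case by (intro bexI[of _ "- y"] bexI[of _ z]) auto
next
  case (m_inv h)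
  then obtain y z where "y \<in> int_adjoin H" "z \<in> int_adjoin H" "z \<noteq> 0" "h = y / z" by blast
  then show ?case using m_inv by (intro bexI[of _ z] bexI[of _ y]) auto
next
  case (eng_add h1 h2)
  then obtain y z y' z' where "y \<in> int_adjoin H" "z \<in> int_adjoin H" "z \<noteq> 0" "h1 = y / z"
    "y' \<in> int_adjoin H" "z' \<in> int_adjoin H" "z' \<noteq> 0" "h2 = y' / z'" by blast
  then show ?case by (intro bexI[of _ "y * z' + y' * z"] bexI[of _ "z * z'"]) (auto simp: field_simps)
next
  case (eng_mult h1 h2)
  then obtain y z y' z' where "y \<in> int_adjoin H" "z \<in> int_adjoin H" "z \<noteq> 0" "h1 = y / z"
    "y' \<in> int_adjoin H" "z' \<in> int_adjoin H" "z' \<noteq> 0" "h2 = y' / z'" by blast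
  then show ?case by (intro bexI[of _ "y * y'"] bexI[of _ "z * z'"]) auto
qed

lemma rat_adjoin_common_denominator:
  assumes "set Ks \<subseteq> rat_adjoin H"
  shows "\<exists>z\<in>int_adjoin H. z \<noteq> 0 \<and> (\<forall>k\<in>set Ks. z * k \<in> int_adjoin H)"
  using assms
proof (induction Ks)
  case Nil
  show ?case by (rule bexI[of _ 1]) auto
next
  case (Cons k Ks)
  then obtain z where z: "z \<in> int_adjoin H" "z \<noteq> 0" "\<forall>k\<in>set Ks. z * k \<in> int_adjoin H" by auto
  obtain y w where yw: "y \<in> int_adjoin H" "w \<in> int_adjoin H" "w \<noteq> 0" "k = y / w"
    using rat_adjoin_fraction[of k H] Cons.prems by auto
  have "w * (z * k') \<in> int_adjoin H" if "k' \<in> set Ks" for k' using z yw that by blast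
  moreover have "w * (z * k) = z * y" using yw by simp
  ultimately show ?case using z yw by (intro bexI[of _ "w * z"]) (auto simp: mult.assoc)
qed

lemma combine_powers:
  "ring.combine ring_of_type_algebra Ks (map (\<lambda>i. \<gamma> ^ i) [k..<k + length Ks])
    = \<gamma> ^ k * poly (Poly Ks) (\<gamma> :: 'a :: comm_ring_1)"
proof -
  interpret ring "ring_of_type_algebra :: 'a ring" by (rule ring_from_type_algebra)
  show ?thesis
  proof (induction Ks arbitrary: k)
    case (Cons c Ks)
    have "[k..<k + length (c # Ks)] = k # [Suc k..<Suc k + length Ks]"
      by (simp add: upt_conv_Cons del: upt_Suc)
    then show ?case using Cons[of "Suc k"] by (simp add: algebra_simps)
  qed simp
qed

text \<open>In a space of dimension \<open>d\<close> the \<open>d + 1\<close> powers of \<gamma> up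
  to exponent \<open>d\<close> are dependent; a common denominator moves the coefficients from
  \<rat>(b) to \<int>[b].\<close>

lemma ext_degree_relation:
  assumes "algebraic \<alpha>" and \<gamma>: "\<gamma> \<in> rat_adjoin {b, \<alpha>}"
  obtains g where "g \<noteq> 0" "degree g \<le> ext_degree (rat_adjoin {b, \<alpha>}) (rat_adjoin {b})"
    "\<forall>i. coeff g i \<in> int_adjoin {b}" "poly g \<gamma> = 0"
proof -
  interpret field "ring_of_type_algebra :: complex ring" by (rule field_from_type_algebra)
  let ?K = "rat_adjoin {b}" and ?L = "rat_adjoin {b, \<alpha>}"
  let ?d = "ext_degree ?L ?K"
  note K = subfield_rat_adjoin[of "{b}"]
  let ?Us = "map (\<lambda>i. \<gamma> ^ i) [0..<Suc ?d]"
  have pow: "\<gamma> ^ i \<in> ?L" for i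
  proof (induction i)
    case 0
    then show ?case using generate_field.one[of ring_of_type_algebra "{b, \<alpha>}"] by (simp add: rat_adjoin_def)
  next
    case (Suc i)
    then show ?case using \<gamma> generate_field.eng_mult[of \<gamma> ring_of_type_algebra "{b, \<alpha>}" "\<gamma> ^ i"]
      by (simp add: rat_adjoin_def)
  qed
  have "dependent ?K ?Us"
  proof
    assume "independent ?K ?Us"
    then have "length ?Us \<le> ?d"
      by (rule independent_length_le_dimension[OF K dimension_rat_adjoin[OF assms(1)]]) (use pow in auto)
    then show False by simp
  qed
  then obtain Ks where Ks: "length Ks = length ?Us" "combine Ks ?Us = 0" "set Ks \<subseteq> ?K" "set Ks \<noteq> {0}"
    using dependent_imp_non_trivial_combine[OF K, of ?Us] by auto
  obtain z where z: "z \<in> int_adjoin {b}" "z \<noteq> 0" "\<forall>k\<in>set Ks. z * k \<in> int_adjoin {b}"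
    using rat_adjoin_common_denominator[OF Ks(3)] by blast
  show ?thesis
  proof (rule that)
    have "set Ks \<noteq> {}" using Ks(1) by auto
    then obtain k where "k \<in> set Ks" "k \<noteq> 0" using Ks(4) by (metis insertI1 set_eq_iff singletonD subset_singletonD subsetI)
    then obtain i where "i < length Ks" "Ks ! i \<noteq> 0" by (auto simp: in_set_conv_nth)
    then have "poly.coeff (Poly Ks) i \<noteq> 0" by (simp add: nth_default_nth)
    then have "Poly Ks \<noteq> 0" by (metis coeff_0)
    then show "smult z (Poly Ks) \<noteq> 0" using z(2) by simp
    show "Polynomial.degree (smult z (Poly Ks)) \<le> ?d"
      using Ks(1) z(2) by (intro degree_le) (auto simp: nth_default_def)
    show "\<forall>i. poly.coeff (smult z (Poly Ks)) i \<in> int_adjoin {b}"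
      using z(3) by (auto simp: nth_default_def)
    show "poly (smult z (Poly Ks)) \<gamma> = 0"
      using combine_powers[of Ks \<gamma> 0] Ks(1,2) by (simp del: upt_Suc)
  qed
qed

section \<open>Preperiodic points\<close>

lemma period_length_pos:
  assumes "is_periodic f x"
  shows "period_length f x \<ge> 1" "(f ^^ period_length f x) x = x"
  using LeastI_ex[of "\<lambda>m. m \<ge> 1 \<and> (f ^^ m) x = x"] assms
  by (auto simp: period_length_def is_periodic_def)

lemma period_length_le:
  assumes "(f ^^ k) x = x" "k \<ge> 1"
  shows "period_length f x \<le> k"
  unfolding period_length_def using assms by (intro Least_le) simp

lemma preperiodic_imp_periodic_iterate:
  assumes "is_preperiodic f x"
  shows "\<exists>m. is_periodic f ((f ^^ m) x)"
proof -
  have "range (\<lambda>m. (f ^^ m) x) = {(f ^^ m) x | m. m \<ge> 0}" by auto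
  then have "finite (range (\<lambda>m. (f ^^ m) x))"
    using assms unfolding is_preperiodic_def by simp
  then have "\<not> inj (\<lambda>m. (f ^^ m) x)" using finite_imageD[of _ UNIV] by auto
  then obtain i j where ij: "i < j" "(f ^^ i) x = (f ^^ j) x"
    unfolding inj_def by (metis linorder_neqE_nat)
  have "(f ^^ (j - i)) ((f ^^ i) x) = (f ^^ (j - i + i)) x" by (simp only: funpow_add comp_apply)
  also have "\<dots> = (f ^^ i) x" using ij by simp
  finally show ?thesis using ij(1) unfolding is_periodic_def
    by (intro exI[of _ i] exI[of _ "j - i"]) auto
qed

text \<open>On a cycle the map can be undone: \<open>N * a - a\<close> further steps complete full
  turns and cancel \<open>f ^^ a\<close>.\<close>

lemma funpow_eq_imp_fixed:
  assumes N: "(f ^^ N) x = x" "N > 0" and eq: "(f ^^ a) x = (f ^^ (a + c)) x"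
  shows "(f ^^ c) x = x"
proof -
  have le: "a \<le> N * a" using N(2) by simp
  have "x = (f ^^ (N * a - a + a)) x" using le funpow_fixed_mult[OF N(1)] by simp
  also have "\<dots> = (f ^^ (N * a - a)) ((f ^^ (a + c)) x)" by (simp only: funpow_add comp_apply eq)
  also have "\<dots> = (f ^^ (N * a - a + (a + c))) x" by (simp only: funpow_add comp_apply)
  also have "N * a - a + (a + c) = c + N * a" using le by simp
  also have "(f ^^ (c + N * a)) x = (f ^^ c) x" using funpow_fixed_mult[OF N(1)] by (simp add: funpow_add)
  finally show ?thesis by simp
qed

text \<open>The iterates \<open>n * j\<close> of \<beta> with \<open>j \<le> degree g\<close> are
  roots of \<open>g\<close>. A period above \<open>n * degree g\<close> would make them distinct,
  one root too many.\<close>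

lemma period_le_degree:
  fixes b \<beta> :: "'a :: field_char_0"
  assumes n: "(quad b ^^ n) 0 = 0" "n > 0" and per: "is_periodic (quad b) \<beta>"
    and g: "\<And>i. coeff g i \<in> int_adjoin {b}" "poly g \<beta> = 0" "g \<noteq> 0"
  shows "period_length (quad b) \<beta> \<le> n * degree g"
proof (rule ccontr)
  let ?F = "quad b"
  define N where "N = period_length ?F \<beta>"
  assume "\<not> ?thesis"
  then have small: "n * degree g < N" by (simp add: N_def)
  have N: "(?F ^^ N) \<beta> = \<beta>" "N > 0" using period_length_pos[OF per] by (auto simp: N_def)
  have root: "poly g ((?F ^^ (n * j)) \<beta>) = 0" for j
  proof (induction j)
    case (Suc j)
    have "poly g ((?F ^^ n) ((?F ^^ (n * j)) \<beta>)) = 0"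
      by (rule quad_iter_conjugate_root[OF n funpow_fixed_funpow[OF N(1)] N(2) g(1) Suc])
    then show ?case by (simp add: funpow_add)
  qed (use g in simp)
  have lt: "(?F ^^ (n * i)) \<beta> \<noteq> (?F ^^ (n * j)) \<beta>" if "i < j" "j \<le> degree g" for i j
  proof
    assume "(?F ^^ (n * i)) \<beta> = (?F ^^ (n * j)) \<beta>"
    moreover have "n * j = n * i + n * (j - i)" using that by (simp add: algebra_simps)
    ultimately have "(?F ^^ (n * (j - i))) \<beta> = \<beta>"
      by (intro funpow_eq_imp_fixed[OF N, of "n * i"]) simp
    then have "N \<le> n * (j - i)"
      unfolding N_def using that n(2) by (intro period_length_le) auto
    also have "\<dots> \<le> n * degree g" using that by (intro mult_left_mono) auto
    finally show False using small by simp
  qed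
  have "inj_on (\<lambda>j. (?F ^^ (n * j)) \<beta>) {..degree g}"
    by (rule linorder_inj_onI) (use lt in auto)
  then have "Suc (degree g) = card ((\<lambda>j. (?F ^^ (n * j)) \<beta>) ` {..degree g})"
    by (simp add: card_image)
  also have "\<dots> \<le> card {x. poly g x = 0}"
    using root by (intro card_mono poly_roots_finite g(3)) auto
  also have "\<dots> \<le> degree g" using g(3) by (rule card_poly_roots_bound)
  finally show False by simp
qed

lemma quad_iter_rat_adjoin:
  assumes "b \<in> H" "x \<in> rat_adjoin H"
  shows "(quad b ^^ k) x \<in> rat_adjoin H"
proof (induction k)
  case (Suc k)
  let ?y = "(quad b ^^ k) x"
  have "?y * ?y + b \<in> rat_adjoin H"
    using Suc assms(1) generate_field.eng_mult[of ?y ring_of_type_algebra H ?y]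
      generate_field.eng_add[of "?y * ?y" ring_of_type_algebra H b] generate_field.incl[of b H ring_of_type_algebra]
    by (simp add: rat_adjoin_def)
  then show ?case by (simp add: power2_eq_square)
qed (use assms in simp)

theorem corollary1p7:
  fixes b \<alpha> :: complex and n :: nat and f :: "complex poly"
  assumes "algebraic b"
    and "f = [:b, 0, 1:]"
    and "is_periodic (poly f) 0"
    and "period_length (poly f) 0 = n"
    and "algebraic \<alpha>"
    and "is_preperiodic (poly f) \<alpha>"
  shows "(2::real) powi (int (preper (poly f) \<alpha>) - 1)
           \<le> real (ext_degree (rat_adjoin {b, \<alpha>}) (rat_adjoin {b}))
       \<and> per (poly f) \<alpha> \<le> n * ext_degree (rat_adjoin {b, \<alpha>}) (rat_adjoin {b})"
proof -
  let ?F = "quad b"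
  let ?d = "ext_degree (rat_adjoin {b, \<alpha>}) (rat_adjoin {b})"
  have F: "poly f = ?F" by (auto simp: assms(2) power2_eq_square)
  have n: "(?F ^^ n) 0 = 0" "n > 0"
    using period_length_pos[OF assms(3)] assms(4) by (auto simp: F)
  define m where "m = preper ?F \<alpha>"
  have ex: "\<exists>m. is_periodic ?F ((?F ^^ m) \<alpha>)"
    using preperiodic_imp_periodic_iterate[OF assms(6)] by (simp add: F)
  define p where "p = (?F ^^ m) \<alpha>"
  have p: "is_periodic ?F p"
    unfolding p_def m_def preper_def using LeastI_ex[OF ex] .
  have \<alpha>: "\<alpha> \<in> rat_adjoin {b, \<alpha>}" by (simp add: rat_adjoin_def generate_field.incl)
  then have pL: "p \<in> rat_adjoin {b, \<alpha>}" unfolding p_def by (intro quad_iter_rat_adjoin) auto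
  obtain g where g: "g \<noteq> 0" "degree g \<le> ?d" "\<forall>i. coeff g i \<in> int_adjoin {b}" "poly g p = 0"
    by (rule ext_degree_relation[OF assms(5) pL])
  have "period_length ?F p \<le> n * degree g" using n p g by (intro period_le_degree) auto
  also have "\<dots> \<le> n * ?d" using g(2) by simp
  finally have part2: "per ?F \<alpha> \<le> n * ?d" by (simp add: per_def p_def m_def)
  obtain h where h: "h \<noteq> 0" "degree h \<le> ?d" "\<forall>i. coeff h i \<in> int_adjoin {b}" "poly h \<alpha> = 0"
    by (rule ext_degree_relation[OF assms(5) \<alpha>])
  have "2 powi (int m - 1) \<le> real ?d"
  proof (cases m)
    case 0
    \<comment> \<open>The exponent is -1 here and the bound is 1/2; it suffices that a nonzero
      polynomial with a root is not constant.\<close>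
    have "degree h \<noteq> 0"
    proof
      assume "degree h = 0"
      then obtain c where "h = [:c:]" by (rule degree_eq_zeroE)
      then show False using h by simp
    qed
    then have "1 \<le> real ?d" using h(2) by simp
    then show ?thesis using 0 by (simp add: power_int_minus)
  next
    case (Suc k)
    define N where "N = period_length ?F p"
    have N: "N \<ge> 1" "(?F ^^ N) p = p" using period_length_pos[OF p] by (auto simp: N_def)
    \<comment> \<open>The predecessor of \<open>p\<close> on its cycle. The iterate \<open>k\<close>
      of \<alpha> is another preimage of \<open>p\<close>, so it is \<beta> or -\<beta>.\<close>
    define \<beta> where "\<beta> = (?F ^^ (N - 1)) p"
    have "?F \<beta> = (?F ^^ Suc (N - 1)) p" by (simp add: \<beta>_def)
    also have "\<dots> = p" using N by simp
    finally have "?F \<beta> = ?F ((?F ^^ k) \<alpha>)" by (simp add: p_def Suc)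
    then have "((?F ^^ k) \<alpha>)\<^sup>2 = \<beta>\<^sup>2" by simp
    moreover have \<beta>_fix: "(?F ^^ N) \<beta> = \<beta>" unfolding \<beta>_def by (rule funpow_fixed_funpow[OF N(2)])
    then have "is_periodic ?F \<beta>" using N(1) by (auto simp: is_periodic_def)
    \<comment> \<open>Minimality of \<open>m = Suc k\<close> rules out the value \<beta>, and with
      it \<beta> = 0, where the two signs agree.\<close>
    moreover have "\<not> is_periodic ?F ((?F ^^ k) \<alpha>)"
      using not_less_Least[of k "\<lambda>m. is_periodic ?F ((?F ^^ m) \<alpha>)"] Suc
      by (simp add: m_def preper_def)
    ultimately have "(?F ^^ k) \<alpha> = - \<beta>" "\<beta> \<noteq> 0" by (auto simp: power2_eq_iff)
    then have "2 ^ k \<le> degree h"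
      using N(1) h by (intro quad_preperiodic_degree[OF n \<beta>_fix]) auto
    then have "2 ^ k \<le> ?d" using h(2) by simp
    then have "2 ^ k \<le> real ?d" by (metis of_nat_le_iff of_nat_numeral of_nat_power)
    then show ?thesis using Suc by simp
  qed
  then show ?thesis using part2 by (simp add: F m_def)
qed

end
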